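(* Let $G$ be a nontrivial finite group and let $V$ be a nonaxial 3D-rotation module for $G$ with axes $A_g$ ($g\in G\setminus\{1\}$). Then $G$ is isomorphic to one of $\mathrm{Alt}(4)$, $\mathrm{Sym}(4)$, $\mathrm{Alt}(5)$, and for every axis $A$ the centralizer $C_G(A)$ is cyclic.
   Context: A $G$-module is an abelian group $V$ (written additively) on which the group $G$ acts on the left by automorphisms. For a subgroup $A\le V$, $C_G(A)=\{h\in G : ha=a \text{ for all } a\in A\}$ is the pointwise stabilizer and $N_G(A)=\{h\in G: hA=A\}$ is the setwise stabilizer. An element $h\in G$ inverts $A$ if $ha=-a$ for all $a\in A$. Definition (3D-rotation module). A $G$-module $V$ is a 3D-rotation module if every nontrivial $g\in G$ can be assigned a nontrivial subgroup $A_g\le V$, called the axis of $g$, such that for all $g,h\in G\setminus\{1\}$: (1) $hA_g=A_{hgh^{-1}}$; (2) $h\in C_G(A_g)$ if and only if $A_h=A_g$; (3) if $h\in N_G(A_g)\setminus C_G(A_g)$, then $h$ inverts $A_g$. The module (with its assignment of axes) is called axial if some axis is $G$-invariant, and nonaxial otherwise. *)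

theory Defs
  imports "HOL-Algebra.Algebra"
begin

text \<open>
  The abelian group \<open>V\<close> is written multiplicatively, as in \<^locale>\<open>comm_group\<close>: its
  neutral element is \<open>\<one>\<^bsub>V\<^esub>\<close> and \<open>-a\<close> becomes \<open>inv\<^bsub>V\<^esub> a\<close>.
  A left action by automorphisms is a homomorphism \<open>\<phi>\<close> from \<open>G\<close> to the automorphism group of
  \<open>V\<close>; it need not be injective.
\<close>

locale G_module = group G + V: comm_group V
  for G :: "('g, 'm) monoid_scheme" (structure)
    and V :: "('v, 'n) monoid_scheme"
    and \<phi> :: "'g \<Rightarrow> 'v \<Rightarrow> 'v" +
  assumes action: "\<phi> \<in> hom G (AutoGroup V)"

definition pointwise_stabilizer ::
    "('g, 'm) monoid_scheme \<Rightarrow> ('g \<Rightarrow> 'v \<Rightarrow> 'v) \<Rightarrow> 'v set \<Rightarrow> 'g set" where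
  "pointwise_stabilizer G \<phi> A = {h \<in> carrier G. \<forall>a\<in>A. \<phi> h a = a}"

definition setwise_stabilizer ::
    "('g, 'm) monoid_scheme \<Rightarrow> ('g \<Rightarrow> 'v \<Rightarrow> 'v) \<Rightarrow> 'v set \<Rightarrow> 'g set" where
  "setwise_stabilizer G \<phi> A = {h \<in> carrier G. \<phi> h ` A = A}"

definition inverts ::
    "('v, 'n) monoid_scheme \<Rightarrow> ('g \<Rightarrow> 'v \<Rightarrow> 'v) \<Rightarrow> 'g \<Rightarrow> 'v set \<Rightarrow> bool" where
  "inverts V \<phi> h A \<longleftrightarrow> (\<forall>a\<in>A. \<phi> h a = inv\<^bsub>V\<^esub> a)"

text \<open>
  The value \<open>axis \<one>\<close> is junk: only the axes of nontrivial elements are constrained or used.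
\<close>

locale rotation_module_3D = G_module G V \<phi>
  for G :: "('g, 'm) monoid_scheme" (structure)
    and V :: "('v, 'n) monoid_scheme"
    and \<phi> :: "'g \<Rightarrow> 'v \<Rightarrow> 'v" +
  fixes axis :: "'g \<Rightarrow> 'v set"
  assumes axis_subgroup: "g \<in> carrier G - {\<one>} \<Longrightarrow> subgroup (axis g) V"
    and axis_nontrivial: "g \<in> carrier G - {\<one>} \<Longrightarrow> axis g \<noteq> {\<one>\<^bsub>V\<^esub>}"
    and axis_conj: "\<lbrakk>g \<in> carrier G - {\<one>}; h \<in> carrier G - {\<one>}\<rbrakk> \<Longrightarrow>
      \<phi> h ` axis g = axis (h \<otimes> g \<otimes> inv h)"
    and axis_centralizer: "\<lbrakk>g \<in> carrier G - {\<one>}; h \<in> carrier G - {\<one>}\<rbrakk> \<Longrightarrow>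
      h \<in> pointwise_stabilizer G \<phi> (axis g) \<longleftrightarrow> axis h = axis g"
    and axis_inverted: "\<lbrakk>g \<in> carrier G - {\<one>}; h \<in> carrier G - {\<one>};
      h \<in> setwise_stabilizer G \<phi> (axis g) - pointwise_stabilizer G \<phi> (axis g)\<rbrakk> \<Longrightarrow>
      inverts V \<phi> h (axis g)"

definition axial ::
    "('g, 'm) monoid_scheme \<Rightarrow> ('g \<Rightarrow> 'v \<Rightarrow> 'v) \<Rightarrow> ('g \<Rightarrow> 'v set) \<Rightarrow> bool" where
  "axial G \<phi> axis \<longleftrightarrow>
    (\<exists>g\<in>carrier G - {\<one>\<^bsub>G\<^esub>}. \<forall>h\<in>carrier G. \<phi> h ` axis g = axis g)"

end

theory Submission
  imports Defs
begin

text \<open>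
  Write \<open>C(A)\<close> and \<open>N(A)\<close> for the pointwise and the setwise stabilizer of an axis \<open>A\<close>.
  By axiom (2), \<open>C(A)\<close> consists of the identity and of the elements whose axis is \<open>A\<close>, so the
  sets \<open>C(A) - {1}\<close> partition \<open>G - {1}\<close>, just as the rotations about the lines through the
  origin do. The proof follows Klein's classification of the finite rotation groups. The elements
  of \<open>N(A) - C(A)\<close> play the part of the half-turns that reverse a line: by axiom (3) the product of
  two of them lies in \<open>C(A)\<close>, so \<open>C(A)\<close> has index \<open>e \<in> {1, 2}\<close> in \<open>N(A)\<close>. Moreover they are
  involutions, since their squares fix two different axes pointwise (\<open>reversing_square\<close>).

  An orbit of \<open>m\<close> axes with stabilizers of orders \<open>c\<close> and \<open>e * c\<close> accounts for \<open>m * (c - 1)\<close>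
  nontrivial elements, where \<open>m * e * c = |G|\<close>. Dividing by \<open>|G|\<close>, the class equation reads
  \<open>1 - 1/|G| = (\<Sum> (1 - 1/c) / e)\<close>. Every summand is at least \<open>1/4\<close>, so there are at most three
  orbits, and if no axis is \<open>G\<close>-invariant (all \<open>m \<ge> 2\<close>) then only the following remain
  (\<open>class_equation_solutions\<close>): \<open>(c, e) = (3, 1), (2, 2)\<close> with \<open>|G| = 12\<close>, or three orbits
  with \<open>e = 2\<close> and \<open>c = 2, 3, 3\<close> or \<open>2, 3, 4\<close> or \<open>2, 3, 5\<close> with \<open>|G| = 12, 24, 60\<close>.

  The group is then recognized from a faithful permutation representation. \<open>G\<close> acts faithfully on
  every orbit of axes for which \<open>c\<close> is odd (\<open>axes_action_faithful\<close>). The orbit with \<open>c = 3\<close> has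
  four axes in the first and the third case, which embeds \<open>G\<close> into \<open>Sym(4)\<close>; in the second case it
  would have only two axes, which is impossible for a group of order 12. In the case \<open>2, 3, 5\<close> the
  subgroups \<open>N(A)\<close> with \<open>|C(A)| = 2\<close> are five Klein four-groups, and \<open>G\<close> acts faithfully on them by
  conjugation (\<open>embedding_by_klein_normalizers\<close>). In the cases of order 12 and 60 more
  than half of the elements have odd order, hence act by even permutations, so the image is the
  alternating group.

  The subgroups \<open>C(A)\<close> have prime order or order 4. In the latter case \<open>e = 2\<close>, and then \<open>C(A)\<close>
  has at most one involution (\<open>involution_unique_in_C\<close>), so it is cyclic.
\<close>

section \<open>The arithmetic of the class equation\<close>

text \<open>
  Dividing \<open>eq\<close> by \<open>N\<close> gives \<open>1/e1 + 1/e2 - 1 + 1/N = 1/(e1 * c1) + 1/(e2 * c2)\<close>. For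
  \<open>e1 = 1\<close> and \<open>e2 = 2\<close> this bounds \<open>c1\<close> and \<open>c2\<close>; for \<open>e1 = e2\<close> it contradicts the assumptions
  on \<open>c\<close> or \<open>m\<close>. In integers: a large \<open>c\<close> makes \<open>m\<close> too small for the sum of the \<open>m\<close>.
\<close>
lemma two_orbit_arith:
  fixes N :: nat
  assumes "e1 \<in> {1,2}" "e2 \<in> {1,2}" "e1 \<le> e2" "c1 \<ge> 2" "c2 \<ge> 2" "m1 \<ge> 2" "m2 \<ge> 2"
    and N: "m1 * e1 * c1 = N" "m2 * e2 * c2 = N"
    and eq: "m1 * (c1 - 1) + m2 * (c2 - 1) + 1 = N"
  shows "e1 = 1 \<and> c1 = 3 \<and> e2 = 2 \<and> c2 = 2 \<and> N = 12"
proof -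
  have w: "m1 * (c1 - 1) + m1 = m1 * c1" "m2 * (c2 - 1) + m2 = m2 * c2"
    using assms(4,5) by (simp_all add: algebra_simps)
  have le: "m1 * 2 \<le> m1 * c1" "m2 * 2 \<le> m2 * c2"
    using assms(4,5) by simp_all
  consider "e1 = 1" "e2 = 1" | "e1 = 1" "e2 = 2" | "e1 = 2" "e2 = 2"
    using assms(1-3) by auto
  then show ?thesis
  proof cases
    case 1
    then have "m1 * c1 = N" "m2 * c2 = N" using N by simp_all
    with w le eq show ?thesis by linarith
  next
    case 2
    have N': "m1 * c1 = N" "2 * (m2 * c2) = N" using N 2 by (simp_all add: algebra_simps)
    have "c1 < 4"
    proof (rule ccontr)
      assume "\<not> c1 < 4"
      then have "m1 * 4 \<le> m1 * c1" by simp
      with w le N' eq show False by linarith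
    qed
    moreover have "c1 \<noteq> 2" using w N' eq assms(6,7) by auto
    ultimately have c1: "c1 = 3" using assms(4) by auto
    have "c2 < 3"
    proof (rule ccontr)
      assume "\<not> c2 < 3"
      then have "m2 * 3 \<le> m2 * c2" by simp
      with w le N'(2) N'(1)[unfolded c1] eq[unfolded c1] show False by simp
    qed
    with assms(5) have "c2 = 2" by auto
    with c1 2 w N' eq show ?thesis by auto
  next
    case 3
    with w N eq assms(6,7) show ?thesis by (simp add: algebra_simps)
  qed
qed

text \<open>
  Divided by \<open>N\<close>, the equation is \<open>1/c1 + 1/c2 + 1/c3 = 1 + 2/N\<close>. The solution family
  \<open>(2, 2, c3)\<close> with \<open>N = 2 * c3\<close>, which belongs to dihedral groups, is ruled out by \<open>m3 \<ge> 2\<close>.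
\<close>
lemma three_orbit_arith:
  fixes N :: nat
  assumes "c1 \<ge> 2" "c1 \<le> c2" "c2 \<le> c3" "m1 \<ge> 2" "m2 \<ge> 2" "m3 \<ge> 2"
    and N: "m1 * 2 * c1 = N" "m2 * 2 * c2 = N" "m3 * 2 * c3 = N"
    and eq: "m1 * (c1 - 1) + m2 * (c2 - 1) + m3 * (c3 - 1) + 1 = N"
  shows "c1 = 2 \<and> c2 = 3 \<and> (c3 = 3 \<and> N = 12 \<or> c3 = 4 \<and> N = 24 \<or> c3 = 5 \<and> N = 60)"
proof -
  have w: "m1 * (c1 - 1) + m1 = m1 * c1" "m2 * (c2 - 1) + m2 = m2 * c2"
    "m3 * (c3 - 1) + m3 = m3 * c3"
    using assms(1-3) by (simp_all add: algebra_simps)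
  define M where "M = m1 * c1"
  have M: "m1 * c1 = M" "m2 * c2 = M" "m3 * c3 = M" "N = 2 * M"
    using N by (simp_all add: M_def algebra_simps)
  have sum: "M + 1 = m1 + m2 + m3" using w M eq by linarith
  have le: "m * k \<le> M" if "m * c = M" "k \<le> c" for m c k :: nat
    using that by auto
  have "c1 < 3"
  proof (rule ccontr)
    assume "\<not> c1 < 3"
    then have "m1 * 3 \<le> M" "m2 * 3 \<le> M" "m3 * 3 \<le> M"
      using le[OF M(1), of 3] le[OF M(2), of 3] le[OF M(3), of 3] assms(1-3) by auto
    with sum show False by linarith
  qed
  then have c1: "c1 = 2" using assms(1) by simp
  have "c2 \<noteq> 2" using M sum c1 assms(6) by auto
  moreover have "c2 < 4"
  proof (rule ccontr)
    assume "\<not> c2 < 4"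
    then have "m2 * 4 \<le> M" "m3 * 4 \<le> M"
      using le[OF M(2), of 4] le[OF M(3), of 4] assms(1-3) by auto
    with sum M(1)[unfolded c1] show False by linarith
  qed
  ultimately have c2: "c2 = 3" using assms(2) c1 by auto
  have "c3 < 6"
  proof (rule ccontr)
    assume "\<not> c3 < 6"
    then have "m3 * 6 \<le> M" using le[OF M(3), of 6] by auto
    with sum M(1)[unfolded c1] M(2)[unfolded c2] show False by linarith
  qed
  then have "c3 = 3 \<or> c3 = 4 \<or> c3 = 5" using assms(3) c2 by auto
  then show ?thesis using c1 c2 sum M by auto
qed

lemma card_three_sorted:
  fixes c :: "'a \<Rightarrow> nat"
  assumes "card \<Omega> = 3"
  obtains x y z where "\<Omega> = {x, y, z}" "x \<noteq> y" "y \<noteq> z" "x \<noteq> z" "c x \<le> c y" "c y \<le> c z"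
proof -
  obtain x y z where xyz: "\<Omega> = {x, y, z}" "x \<noteq> y" "y \<noteq> z" "x \<noteq> z"
    using assms by (auto simp: card_3_iff)
  consider "c x \<le> c y" "c y \<le> c z" | "c x \<le> c z" "c z \<le> c y" | "c y \<le> c x" "c x \<le> c z"
    | "c y \<le> c z" "c z \<le> c x" | "c z \<le> c x" "c x \<le> c y" | "c z \<le> c y" "c y \<le> c x"
    by linarith
  then show ?thesis
  proof cases
    case 1 with xyz show ?thesis by (intro that[of x y z]) auto
  next
    case 2 with xyz show ?thesis by (intro that[of x z y]) auto
  next
    case 3 with xyz show ?thesis by (intro that[of y x z]) auto
  next
    case 4 with xyz show ?thesis by (intro that[of y z x]) auto
  next
    case 5 with xyz show ?thesis by (intro that[of z x y]) auto
  next
    case 6 with xyz show ?thesis by (intro that[of z y x]) auto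
  qed
qed

text \<open>
  Each orbit contributes at least \<open>N / 4\<close> to the sum, and at least \<open>N / 2\<close> if \<open>e = 1\<close>. As the sum is
  less than \<open>N\<close>, there are at most three orbits, and if there are three then all have \<open>e = 2\<close>. A
  single orbit is impossible: it would contribute all of \<open>N - 1\<close>, which forces \<open>e = m = 1\<close>.
\<close>
lemma class_equation_solutions:
  fixes m c e :: "'a \<Rightarrow> nat"
  assumes fin: "finite \<Omega>"
    and c: "\<And>x. x \<in> \<Omega> \<Longrightarrow> c x \<ge> 2" and e: "\<And>x. x \<in> \<Omega> \<Longrightarrow> e x \<in> {1, 2}"
    and m: "\<And>x. x \<in> \<Omega> \<Longrightarrow> m x \<ge> 2" and N: "\<And>x. x \<in> \<Omega> \<Longrightarrow> m x * e x * c x = N"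
    and eq: "(\<Sum>x\<in>\<Omega>. m x * (c x - 1)) + 1 = N" and N1: "N > 1"
  shows "(\<exists>x y. \<Omega> = {x, y} \<and> x \<noteq> y \<and> c x = 3 \<and> e x = 1 \<and> c y = 2 \<and> e y = 2 \<and> N = 12) \<or>
    (\<exists>x y z. \<Omega> = {x, y, z} \<and> x \<noteq> y \<and> y \<noteq> z \<and> x \<noteq> z \<and> e x = 2 \<and> e y = 2 \<and> e z = 2 \<and>
      c x = 2 \<and> c y = 3 \<and> (c z = 3 \<and> N = 12 \<or> c z = 4 \<and> N = 24 \<or> c z = 5 \<and> N = 60))"
proof -
  have wc: "m x * (c x - 1) + m x = m x * c x" if "x \<in> \<Omega>" for x
    using c[OF that] by (simp add: algebra_simps)
  have c2: "m x * 2 \<le> m x * c x" if "x \<in> \<Omega>" for x using c[OF that] by simp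
  have w: "N \<le> 4 * (m x * (c x - 1))" "e x = 1 \<Longrightarrow> N \<le> 2 * (m x * (c x - 1))" if "x \<in> \<Omega>" for x
  proof -
    have "N = m x * c x \<or> N = 2 * (m x * c x)"
      using e[OF that] N[OF that] by auto
    moreover have "e x = 1 \<Longrightarrow> N = m x * c x" using N[OF that] by simp
    ultimately show "N \<le> 4 * (m x * (c x - 1))" "e x = 1 \<Longrightarrow> N \<le> 2 * (m x * (c x - 1))"
      using wc[OF that] c2[OF that] by linarith+
  qed
  have "card \<Omega> * N \<le> (\<Sum>x\<in>\<Omega>. 4 * (m x * (c x - 1)))"
    using sum_bounded_below[of \<Omega> N "\<lambda>x. 4 * (m x * (c x - 1))"] w by simp
  also have "\<dots> = 4 * (\<Sum>x\<in>\<Omega>. m x * (c x - 1))"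
    by (rule sum_distrib_left[symmetric])
  also have "\<dots> < 4 * N" using eq by linarith
  finally have "card \<Omega> < 4" by simp
  then consider "card \<Omega> = 0" | "card \<Omega> = 1" | "card \<Omega> = 2" | "card \<Omega> = 3" by linarith
  then show ?thesis
  proof cases
    case 1
    with fin eq N1 show ?thesis by simp
  next
    case 2
    then obtain x where x: "\<Omega> = {x}" by (auto simp: card_1_singleton_iff)
    have "m x * (c x - 1) + 1 = N" using eq x by simp
    moreover have "N = m x * c x \<or> N = 2 * (m x * c x)"
      using e[of x] N[of x] x by auto
    ultimately have False using wc[of x] m[of x] x by auto
    then show ?thesis ..
  next
    case 3
    then obtain x y where xy: "\<Omega> = {x, y}" "x \<noteq> y" "e x \<le> e y"
      by (metis card_2_iff insert_commute nle_le)
    have in2: "x \<in> \<Omega>" "y \<in> \<Omega>" using xy by auto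
    have s: "m x * (c x - 1) + m y * (c y - 1) + 1 = N" using eq xy by simp
    have "e x = 1 \<and> c x = 3 \<and> e y = 2 \<and> c y = 2 \<and> N = 12"
      using two_orbit_arith[OF e[OF in2(1)] e[OF in2(2)] xy(3) c[OF in2(1)] c[OF in2(2)]
        m[OF in2(1)] m[OF in2(2)] N[OF in2(1)] N[OF in2(2)] s] .
    with xy show ?thesis by blast
  next
    case 4
    then obtain x y z where xyz: "\<Omega> = {x, y, z}" "x \<noteq> y" "y \<noteq> z" "x \<noteq> z" "c x \<le> c y" "c y \<le> c z"
      by (rule card_three_sorted)
    have s: "m x * (c x - 1) + m y * (c y - 1) + m z * (c z - 1) + 1 = N"
      using eq xyz by (simp add: add.assoc)
    have in3: "x \<in> \<Omega>" "y \<in> \<Omega>" "z \<in> \<Omega>" using xyz by auto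
    have "e x \<noteq> 1" "e y \<noteq> 1" "e z \<noteq> 1"
      using w[OF in3(1)] w[OF in3(2)] w[OF in3(3)] s by linarith+
    then have e2: "e x = 2" "e y = 2" "e z = 2" using e in3 by blast+
    have "c x = 2 \<and> c y = 3 \<and> (c z = 3 \<and> N = 12 \<or> c z = 4 \<and> N = 24 \<or> c z = 5 \<and> N = 60)"
      using three_orbit_arith[OF c[OF in3(1)] xyz(5,6) m[OF in3(1)] m[OF in3(2)] m[OF in3(3)]
        N[OF in3(1), unfolded e2] N[OF in3(2), unfolded e2] N[OF in3(3), unfolded e2] s] .
    with xyz e2 show ?thesis by blast
  qed
qed

section \<open>Permutation representations\<close>

text \<open>
  The restriction is there because the elements of \<^const>\<open>BijGroup\<close> are extensional functions,
  while a natural formula for an action is also defined outside \<open>E\<close>.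
\<close>
lemma (in group) group_action_restrictI:
  assumes closed: "\<And>g x. g \<in> carrier G \<Longrightarrow> x \<in> E \<Longrightarrow> a g x \<in> E"
    and one: "\<And>x. x \<in> E \<Longrightarrow> a \<one> x = x"
    and mult: "\<And>g h x. g \<in> carrier G \<Longrightarrow> h \<in> carrier G \<Longrightarrow> x \<in> E \<Longrightarrow> a (g \<otimes> h) x = a g (a h x)"
  shows "group_action G E (\<lambda>g. restrict (a g) E)"
proof -
  have bij: "restrict (a g) E \<in> Bij E" if g: "g \<in> carrier G" for g
  proof -
    have "bij_betw (a g) E E"
      using g by (intro bij_betw_byWitness[where f' = "a (inv g)"])
        (auto simp: closed one simp flip: mult)
    then show ?thesis by (simp add: Bij_def)
  qed
  have "(\<lambda>g. restrict (a g) E) \<in> hom G (BijGroup E)"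
    by (rule homI) (auto simp: BijGroup_def bij compose_def mult closed intro!: restrict_ext)
  then show ?thesis
    by (simp add: group_action_def group_hom_def group_hom_axioms_def group_BijGroup)
qed

lemma (in group) faithful_actionI:
  assumes act: "group_action G E \<psi>"
    and triv: "\<And>g. g \<in> carrier G \<Longrightarrow> (\<And>x. x \<in> E \<Longrightarrow> \<psi> g x = x) \<Longrightarrow> g = \<one>"
  shows "faithful_action G E \<psi>"
proof -
  interpret group_action G E \<psi> by (rule act)
  interpret H: group_hom G "BijGroup E" \<psi> by (rule group_hom)
  have "g = \<one>" if "g \<in> carrier G" "\<psi> g = \<one>\<^bsub>BijGroup E\<^esub>" for g
    using that by (intro triv) (auto simp: BijGroup_def)
  then have "inj_on \<psi> (carrier G)"
    by (metis H.inj_on_one_iff)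
  then show ?thesis by unfold_locales
qed

lemma (in faithful_action) embedding_into_sym_group:
  assumes "finite E" "card E = n"
  shows "\<exists>\<rho>\<in>hom G (sym_group n). inj_on \<rho> (carrier G)"
proof -
  interpret group_hom G "BijGroup E" \<phi> by (rule group_hom)
  obtain f where f: "bij_betw f {1..n} E"
    using assms by (metis bij_betw_iff_card card_atLeastAtMost diff_Suc_1 finite_atLeastAtMost)
  let ?f' = "the_inv_into {1..n} f"
  have f': "?f' x \<in> {1..n}" "f (?f' x) = x" if "x \<in> E" for x
    using that f the_inv_into_into[of f "{1..n}" x "{1..n}"]
    by (auto simp: bij_betw_def f_the_inv_into_f simp del: atLeastAtMost_iff)
  have f'f: "?f' (f i) = i" if "i \<in> {1..n}" for i
    using that f by (simp add: bij_betw_def the_inv_into_f_f)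
  have fE: "f i \<in> E" if "i \<in> {1..n}" for i using that f by (auto simp: bij_betw_def)
  define \<rho> where "\<rho> g = (\<lambda>i. if i \<in> {1..n} then ?f' (\<phi> g (f i)) else i)" for g
  have act: "\<phi> g x \<in> E" if "g \<in> carrier G" "x \<in> E" for g x
    using that surj_prop by blast
  have mult: "\<phi> (g \<otimes> h) x = \<phi> g (\<phi> h x)" if "g \<in> carrier G" "h \<in> carrier G" "x \<in> E" for g h x
    using that composition_rule by simp
  have \<rho>_in: "\<rho> g i \<in> {1..n}" if "g \<in> carrier G" "i \<in> {1..n}" for g i
    using that f' act fE unfolding \<rho>_def by presburger
  have \<rho>_mult: "\<rho> (g \<otimes> h) = \<rho> g \<circ> \<rho> h" if gh: "g \<in> carrier G" "h \<in> carrier G" for g h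
  proof
    fix i
    show "\<rho> (g \<otimes> h) i = (\<rho> g \<circ> \<rho> h) i"
    proof (cases "i \<in> {1..n}")
      case True
      then show ?thesis
        using gh \<rho>_in[of h i] by (simp add: \<rho>_def mult act fE f' del: atLeastAtMost_iff One_nat_def hom_mult)
    qed (auto simp: \<rho>_def)
  qed
  have \<rho>_one: "\<rho> \<one> = id"
  proof -
    have "\<phi> \<one> x = x" if "x \<in> E" for x
      using that id_eq_one by (metis restrict_apply')
    then show ?thesis
      by (intro ext) (simp add: \<rho>_def f'f fE del: atLeastAtMost_iff One_nat_def hom_one)
  qed
  have perm: "\<rho> g permutes {1..n}" if g: "g \<in> carrier G" for g
  proof -
    have "bij_betw (\<rho> g) {1..n} {1..n}"
      using g \<rho>_mult[of "inv g" g] \<rho>_mult[of g "inv g"] \<rho>_one \<rho>_in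
      by (intro bij_betw_byWitness[where f' = "\<rho> (inv g)"]) (auto simp: fun_eq_iff)
    then show ?thesis by (rule bij_imp_permutes) (auto simp: \<rho>_def)
  qed
  have "\<rho> \<in> hom G (sym_group n)"
    by (rule homI) (simp_all add: sym_group_def perm \<rho>_mult del: One_nat_def)
  moreover have "inj_on \<rho> (carrier G)"
  proof (rule inj_onI)
    fix g h assume gh: "g \<in> carrier G" "h \<in> carrier G" "\<rho> g = \<rho> h"
    have "\<phi> g x = \<phi> h x" if x: "x \<in> E" for x
    proof -
      have "\<rho> g (?f' x) = \<rho> h (?f' x)" using gh by simp
      then have "?f' (\<phi> g x) = ?f' (\<phi> h x)" using f'[OF x] by (simp add: \<rho>_def)
      then show ?thesis using f' act gh x by metis
    qed
    moreover have "\<phi> g \<in> extensional E" "\<phi> h \<in> extensional E"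
      using bij_prop0 gh by (auto simp: Bij_def)
    ultimately have "\<phi> g = \<phi> h" by (metis extensionalityI)
    then show "g = h" using faithful gh by (meson inj_onD)
  qed
  ultimately show ?thesis by blast
qed

lemma inj_hom_imp_iso:
  assumes "h \<in> hom G H" "inj_on h (carrier G)" "h ` carrier G \<subseteq> carrier K"
    and "finite (carrier K)" "card (carrier K) = card (carrier G)" "\<And>x y. x \<otimes>\<^bsub>K\<^esub> y = x \<otimes>\<^bsub>H\<^esub> y"
  shows "G \<cong> K"
proof -
  have "h ` carrier G = carrier K"
    using assms by (metis card_image card_subset_eq)
  with assms show ?thesis
    by (intro is_isoI[of h]) (auto simp: iso_def hom_def bij_betw_def)
qed

lemma (in group) iso_sym_group:
  assumes \<rho>: "\<rho> \<in> hom G (sym_group n)" "inj_on \<rho> (carrier G)" and ord: "order G = fact n"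
  shows "G \<cong> sym_group n"
proof (rule inj_hom_imp_iso[OF \<rho>])
  show "\<rho> ` carrier G \<subseteq> carrier (sym_group n)" using \<rho> by (auto simp: hom_def)
  show "finite (carrier (sym_group n))" "card (carrier (sym_group n)) = card (carrier G)"
    using ord by (simp_all add: sym_group_def order_def finite_permutations card_permutations[OF refl])
qed simp

text \<open>
  An element of odd order acts by an even permutation, since its sign is an odd root of 1. The even
  elements thus form a subgroup with more than half of the elements of \<open>G\<close>, so that subgroup is \<open>G\<close>.
\<close>
lemma (in group) iso_alt_group:
  assumes \<rho>: "\<rho> \<in> hom G (sym_group n)" "inj_on \<rho> (carrier G)"
    and ord: "2 * order G = fact n" and n: "n \<ge> 2"
    and S: "S \<subseteq> carrier G" "2 * card S > order G"
    and odd: "\<And>h. h \<in> S \<Longrightarrow> \<exists>k. odd k \<and> h [^] (k::nat) = \<one>"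
  shows "G \<cong> alt_group n"
proof -
  have "order G > 0" using S(2) card_mono[of "carrier G" S] ord
    by (metis fact_gt_zero gr0I mult_0_right not_less_zero)
  then have fin: "finite (carrier G)" by (simp add: order_gt_0_iff_finite)
  interpret \<rho>: group_hom G "sym_group n" \<rho>
    by (simp add: group_hom_def group_hom_axioms_def \<rho> sym_group_is_group)
  interpret sg: group_hom "sym_group n" sign_img "sign :: (nat \<Rightarrow> nat) \<Rightarrow> int"
    by (rule sign_group_hom)
  interpret SR: group_hom G sign_img "sign \<circ> \<rho>"
    by (simp add: group_hom_def group_hom_axioms_def sign_img_is_group
        Group.hom_compose[OF \<rho>(1) sign_is_hom])
  let ?K = "kernel G sign_img (sign \<circ> \<rho>)"
  have "S \<subseteq> ?K"
  proof
    fix h assume h: "h \<in> S"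
    then obtain k where k: "odd k" "h [^] (k::nat) = \<one>" using odd by blast
    have hG: "h \<in> carrier G" using h S by auto
    have "(sign (\<rho> h) :: int) [^]\<^bsub>sign_img\<^esub> k = \<one>\<^bsub>sign_img\<^esub>"
      using SR.hom_nat_pow[OF hG, of k] k SR.hom_one by simp
    moreover have "(x::int) [^]\<^bsub>sign_img\<^esub> j = x ^ j" for x and j :: nat
      by (induction j) (simp_all add: sign_img_def)
    ultimately have "(sign (\<rho> h) :: int) ^ k = 1" by (simp add: sign_img_def)
    then have "sign (\<rho> h) = (1::int)"
      using k(1) by (auto simp: sign_def split: if_splits)
    then show "h \<in> ?K" using hG by (simp add: kernel_def sign_img_def)
  qed
  have sub: "subgroup ?K G" by (rule SR.subgroup_kernel)
  then have "card (rcosets ?K) * card ?K = order G" by (rule lagrange)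
  moreover have "2 * card ?K > order G"
    using S card_mono[OF finite_subset[OF subgroup.subset[OF sub] fin] \<open>S \<subseteq> ?K\<close>] by linarith
  ultimately have "card (rcosets ?K) * card ?K < 2 * card ?K" "card (rcosets ?K) * card ?K > 0"
    using \<open>order G > 0\<close> by simp_all
  then have "card (rcosets ?K) = 1" by (auto simp: less_2_cases_iff)
  with \<open>card (rcosets ?K) * card ?K = order G\<close> have "card ?K = card (carrier G)"
    by (simp add: order_def)
  then have K: "?K = carrier G"
    using subgroup.subset[OF sub] fin by (simp add: card_subset_eq)
  show ?thesis
  proof (rule inj_hom_imp_iso[OF \<rho>])
    show "\<rho> ` carrier G \<subseteq> carrier (alt_group n)"
    proof
      fix p assume "p \<in> \<rho> ` carrier G"
      then obtain g where g: "g \<in> carrier G" "p = \<rho> g" by blast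
      then have "sign p = (1::int)" using K by (auto simp: kernel_def sign_img_def)
      then show "p \<in> carrier (alt_group n)"
        using g \<rho>(1) by (auto simp: alt_group_carrier hom_def sym_group_carrier sign_def split: if_splits)
    qed
    show "finite (carrier (alt_group n))" 
      by (rule finite_subset[OF _ finite_permutations[of "{1..n}"]]) (auto simp: alt_group_carrier)
    show "card (carrier (alt_group n)) = card (carrier G)"
      using alt_group_card_carrier[OF n] ord by (simp add: order_def)
  qed (simp add: alt_group_mult sym_group_mult)
qed

section \<open>Subgroups and element orders\<close>

lemma (in group) conj_eq_one_iff:
  assumes "g \<in> carrier G" "h \<in> carrier G"
  shows "h \<otimes> g \<otimes> inv h = \<one> \<longleftrightarrow> g = \<one>"
  using assms by (metis conjugation_is_inj one_closed r_inv r_one)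

lemma (in group) pow_card_subgroup:
  assumes "subgroup H G" "x \<in> H"
  shows "x [^] card H = \<one>"
proof -
  interpret H: group "G\<lparr>carrier := H\<rparr>" by (rule subgroup_imp_group[OF assms(1)])
  have "x [^]\<^bsub>G\<lparr>carrier := H\<rparr>\<^esub> card H = \<one>\<^bsub>G\<lparr>carrier := H\<rparr>\<^esub>"
    using H.pow_order_eq_1 assms(2) by (simp add: order_def)
  then show ?thesis by (simp add: nat_pow_consistent[symmetric])
qed

lemma (in group) odd_subgroup_no_involution:
  assumes "subgroup H G" "odd (card H)" "x \<in> H" "x \<otimes> x = \<one>"
  shows "x = \<one>"
proof -
  have x: "x \<in> carrier G" using assms subgroup.mem_carrier by metis
  obtain k where k: "card H = Suc (2 * k)" using assms(2) by (auto elim: oddE)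
  have "x [^] (2::nat) = \<one>" using x assms(4) by (simp add: numeral_2_eq_2)
  then have "x [^] (2 * k) = \<one>" using nat_pow_pow[OF x, of 2 k] by simp
  then have "x [^] card H = x" using x k by simp
  with pow_card_subgroup[OF assms(1,3)] show ?thesis by simp
qed

lemma (in group) cyclic_subgroup_if_ord:
  assumes "subgroup H G" "finite H" "x \<in> H" "ord x = card H"
  shows "cyclic_group (G\<lparr>carrier := H\<rparr>)"
proof -
  have x: "x \<in> carrier G" using assms subgroup.mem_carrier by metis
  have "generate G {x} \<subseteq> H"
    using generate_subgroup_incl[of "{x}" H] assms by simp
  moreover have "card (generate G {x}) = card H"
    using generate_pow_card[OF x] assms(4) by simp
  ultimately have "generate G {x} = H" using assms(2) by (simp add: card_subset_eq)
  then have "G\<lparr>carrier := H\<rparr> = subgroup_generated G {x}"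
    using x by (simp add: subgroup_generated_def)
  then show ?thesis using cyclic_group_generated by simp
qed

section \<open>Stabilizers of axes\<close>

context rotation_module_3D
begin

abbreviation C where "C \<equiv> pointwise_stabilizer G \<phi>"
abbreviation N where "N \<equiv> setwise_stabilizer G \<phi>"

definition axes where "axes = axis ` (carrier G - {\<one>})"

lemma act_one: "a \<in> carrier V \<Longrightarrow> \<phi> \<one> a = a"
  and act_mult: "g \<in> carrier G \<Longrightarrow> h \<in> carrier G \<Longrightarrow> a \<in> carrier V \<Longrightarrow> \<phi> (g \<otimes> h) a = \<phi> g (\<phi> h a)"
  and act_closed: "g \<in> carrier G \<Longrightarrow> a \<in> carrier V \<Longrightarrow> \<phi> g a \<in> carrier V"
proof -
  interpret A: group_hom G "AutoGroup V" \<phi>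
    by (simp add: group_hom_def group_hom_axioms_def action V.AutoGroup)
  show "a \<in> carrier V \<Longrightarrow> \<phi> \<one> a = a"
    using A.hom_one by (simp add: AutoGroup_def BijGroup_def)
  have Bij: "\<phi> g \<in> Bij (carrier V)" if "g \<in> carrier G" for g
    using A.hom_closed[OF that] by (simp add: AutoGroup_def auto_def)
  show "\<phi> (g \<otimes> h) a = \<phi> g (\<phi> h a)"
    if "g \<in> carrier G" "h \<in> carrier G" "a \<in> carrier V"
    using A.hom_mult[OF that(1,2)] that Bij
    by (simp add: AutoGroup_def BijGroup_def compose_eq)
  show "g \<in> carrier G \<Longrightarrow> a \<in> carrier V \<Longrightarrow> \<phi> g a \<in> carrier V"
    using Bij Bij_imp_funcset by blast
qed

lemma image_mult:
  "g \<in> carrier G \<Longrightarrow> h \<in> carrier G \<Longrightarrow> A \<subseteq> carrier V \<Longrightarrow> \<phi> (g \<otimes> h) ` A = \<phi> g ` \<phi> h ` A"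
  by (auto simp: image_image act_mult subset_iff cong: image_cong_simp)

lemma image_one: "A \<subseteq> carrier V \<Longrightarrow> \<phi> \<one> ` A = A"
  by (auto simp: image_iff act_one subset_iff)

lemma image_subset: "g \<in> carrier G \<Longrightarrow> A \<subseteq> carrier V \<Longrightarrow> \<phi> g ` A \<subseteq> carrier V"
  using act_closed by auto

lemma axes_subset: "A \<in> axes \<Longrightarrow> A \<subseteq> carrier V"
  using axis_subgroup subgroup.subset by (fastforce simp: axes_def)

text \<open>The conjugation axiom, extended to \<open>h = \<one>\<close>.\<close>
lemma image_axis:
  assumes "h \<in> carrier G" "g \<in> carrier G - {\<one>}"
  shows "\<phi> h ` axis g = axis (h \<otimes> g \<otimes> inv h)"
proof (cases "h = \<one>")
  case True
  then show ?thesis using assms image_one axes_subset[of "axis g"] by (auto simp: axes_def)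
next
  case False
  then show ?thesis using assms axis_conj by simp
qed

lemma image_axes: "h \<in> carrier G \<Longrightarrow> A \<in> axes \<Longrightarrow> \<phi> h ` A \<in> axes"
proof -
  assume h: "h \<in> carrier G" and "A \<in> axes"
  then obtain g where g: "g \<in> carrier G - {\<one>}" "A = axis g" by (auto simp: axes_def)
  then have "h \<otimes> g \<otimes> inv h \<in> carrier G - {\<one>}" using h conj_eq_one_iff by simp
  then show "\<phi> h ` A \<in> axes" using image_axis[OF h g(1)] g(2) by (auto simp: axes_def)
qed

lemma C_iff:
  assumes "A \<in> axes" and "h \<in> carrier G"
  shows "h \<in> C A \<longleftrightarrow> h = \<one> \<or> axis h = A"
proof -
  obtain g where g: "g \<in> carrier G - {\<one>}" "A = axis g" using assms by (auto simp: axes_def)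
  have "\<one> \<in> C A"
    using act_one axes_subset[OF assms(1)] by (auto simp: pointwise_stabilizer_def)
  then show ?thesis using axis_centralizer[OF g(1), of h] g assms(2) by auto
qed

lemma subgroup_C: "A \<subseteq> carrier V \<Longrightarrow> subgroup (C A) G"
proof (rule subgroupI)
  assume A: "A \<subseteq> carrier V"
  show "C A \<subseteq> carrier G" by (auto simp: pointwise_stabilizer_def)
  show "C A \<noteq> {}" using act_one A by (auto simp: pointwise_stabilizer_def)
  fix a assume a: "a \<in> C A"
  have "\<phi> (inv a) x = x" if "x \<in> A" for x
    using a that A act_mult[of "inv a" a x] act_one[of x] by (auto simp: pointwise_stabilizer_def)
  with a show "inv a \<in> C A" by (auto simp: pointwise_stabilizer_def)
  fix b assume b: "b \<in> C A"
  with a show "a \<otimes> b \<in> C A"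
    using act_mult A by (auto simp: pointwise_stabilizer_def subset_iff)
qed

lemma subgroup_N: "A \<subseteq> carrier V \<Longrightarrow> subgroup (N A) G"
proof (rule subgroupI)
  assume A: "A \<subseteq> carrier V"
  show "N A \<subseteq> carrier G" by (auto simp: setwise_stabilizer_def)
  show "N A \<noteq> {}" using image_one A by (auto simp: setwise_stabilizer_def)
  fix a assume a: "a \<in> N A"
  then show "inv a \<in> N A"
    using A image_mult[of "inv a" a A] image_one[of A] by (auto simp: setwise_stabilizer_def)
  fix b assume b: "b \<in> N A"
  with a show "a \<otimes> b \<in> N A"
    using image_mult A by (auto simp: setwise_stabilizer_def)
qed

lemma C_subset_N: "C A \<subseteq> N A"
  by (force simp: pointwise_stabilizer_def setwise_stabilizer_def)

lemma C_carrier: "h \<in> C A \<Longrightarrow> h \<in> carrier G" and N_carrier: "h \<in> N A \<Longrightarrow> h \<in> carrier G"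
  by (auto simp: pointwise_stabilizer_def setwise_stabilizer_def)

text \<open>An element that commutes with \<open>g\<close> maps the axis of \<open>g\<close> to itself, by the conjugation axiom.\<close>
lemma commuting_in_N:
  assumes "g \<in> carrier G - {\<one>}" "h \<in> carrier G" "h \<otimes> g = g \<otimes> h"
  shows "h \<in> N (axis g)"
  using assms image_axis[of h g] by (simp add: setwise_stabilizer_def m_assoc)

text \<open>Both factors invert \<open>A\<close>, so their product fixes \<open>A\<close> pointwise.\<close>
lemma reversing_mult:
  assumes "A \<in> axes" "h \<in> N A - C A" "k \<in> N A - C A"
  shows "h \<otimes> k \<in> C A"
proof -
  obtain g where g: "g \<in> carrier G - {\<one>}" "A = axis g" using assms by (auto simp: axes_def)
  interpret A: subgroup A V using axis_subgroup g by simp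
  have inv: "inverts V \<phi> x A" if "x \<in> N A - C A" for x
  proof -
    have "x \<noteq> \<one>" using that C_iff[OF assms(1), of \<one>] by auto
    then show ?thesis using axis_inverted[OF g(1), of x] that g N_carrier by blast
  qed
  have "\<phi> (h \<otimes> k) a = a" if "a \<in> A" for a
    using that inv[OF assms(2)] inv[OF assms(3)] assms N_carrier
    by (auto simp: inverts_def act_mult A.mem_carrier)
  then show ?thesis using assms N_carrier by (auto simp: pointwise_stabilizer_def)
qed

text \<open>
  The square fixes both \<open>A\<close> and the axis of \<open>h\<close> pointwise. These axes differ, and pointwise
  stabilizers of different axes meet trivially.
\<close>
lemma reversing_square:
  assumes A: "A \<in> axes" and h: "h \<in> N A - C A"
  shows "h \<otimes> h = \<one>"
proof (rule ccontr)
  assume hh: "h \<otimes> h \<noteq> \<one>"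
  have hG: "h \<in> carrier G" using h N_carrier by blast
  with hh have h1: "h \<in> carrier G - {\<one>}" by auto
  then have B: "axis h \<in> axes" by (simp add: axes_def)
  have "h \<in> C (axis h)" using C_iff[OF B hG] by (simp add: hG)
  then have "h \<otimes> h \<in> C (axis h)"
    using subgroup_C[OF axes_subset[OF B]] subgroup.m_closed by metis
  moreover have "h \<otimes> h \<in> C A" using reversing_mult[OF A h h] .
  ultimately have "axis h = A" using hh hG C_iff[OF A, of "h \<otimes> h"] C_iff[OF B, of "h \<otimes> h"] by auto
  then show False using h C_iff[OF A hG] by (simp add: hG)
qed

lemma reversing_mult_C:
  assumes A: "A \<in> axes" and h: "h \<in> N A - C A" and s: "s \<in> C A"
  shows "h \<otimes> s \<in> N A - C A"
proof -
  interpret C: subgroup "C A" G by (rule subgroup_C[OF axes_subset[OF A]])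
  interpret N: subgroup "N A" G by (rule subgroup_N[OF axes_subset[OF A]])
  have sN: "s \<in> N A" using s C_subset_N by blast
  have "h = h \<otimes> s \<otimes> inv s" using h s by (simp add: m_assoc)
  then have "h \<otimes> s \<notin> C A" using h s by (metis C.m_closed C.m_inv_closed DiffD2)
  then show ?thesis using h sN by simp
qed

text \<open>If some \<open>h\<close> reverses \<open>A\<close>, then the elements that reverse \<open>A\<close> form the coset \<open>h C(A)\<close>.\<close>
lemma card_N:
  assumes fin: "finite (carrier G)" and A: "A \<in> axes"
  shows "card (N A) = card (C A) \<or> card (N A) = 2 * card (C A)"
proof (cases "N A = C A")
  case False
  then obtain h where h: "h \<in> N A - C A" using C_subset_N by blast
  have hG: "h \<in> carrier G" using h N_carrier by blast
  have finN: "finite (N A)" using fin N_carrier by (meson finite_subset subsetI)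
  have "N A - C A = (\<lambda>s. h \<otimes> s) ` C A"
  proof
    show "(\<lambda>s. h \<otimes> s) ` C A \<subseteq> N A - C A" using reversing_mult_C[OF A h] by blast
    show "N A - C A \<subseteq> (\<lambda>s. h \<otimes> s) ` C A"
    proof
      fix k assume k: "k \<in> N A - C A"
      then have "k = h \<otimes> (h \<otimes> k)"
        using reversing_square[OF A h] hG N_carrier[of k A] by (simp flip: m_assoc)
      then show "k \<in> (\<lambda>s. h \<otimes> s) ` C A" using reversing_mult[OF A h k] by blast
    qed
  qed
  moreover have "inj_on (\<lambda>s. h \<otimes> s) (C A)"
    using hG C_carrier by (intro inj_onI) simp
  ultimately have "card (N A - C A) = card (C A)" by (simp add: card_image)
  moreover have "card (N A - C A) = card (N A) - card (C A)" "card (C A) \<le> card (N A)"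
    using C_subset_N finN by (auto intro: card_Diff_subset finite_subset card_mono)
  ultimately show ?thesis by linarith
qed simp

text \<open>
  For an involution \<open>s\<close> in \<open>C(A)\<close>, the element \<open>h s\<close> reverses \<open>A\<close> and so is an involution as well.
  Hence \<open>s\<close> commutes with \<open>h\<close>, and \<open>s\<close> reverses the axis of \<open>h\<close>. Two such involutions have a product
  that fixes both \<open>A\<close> and the axis of \<open>h\<close> pointwise, so this product is trivial.
\<close>
lemma involution_unique_in_C:
  assumes A: "A \<in> axes" and h: "h \<in> N A - C A"
    and s: "s \<in> C A" "s \<noteq> \<one>" "s \<otimes> s = \<one>" and t: "t \<in> C A" "t \<noteq> \<one>" "t \<otimes> t = \<one>"
  shows "s = t"
proof (rule ccontr)
  assume "s \<noteq> t"
  have G: "h \<in> carrier G" "s \<in> carrier G" "t \<in> carrier G" using h s t N_carrier C_carrier by blast+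
  have h1: "h \<in> carrier G - {\<one>}" using h G C_iff[OF A, of h] by auto
  then have B: "axis h \<in> axes" by (simp add: axes_def)
  have rev: "x \<in> N (axis h) - C (axis h)" if x: "x \<in> C A" "x \<noteq> \<one>" "x \<otimes> x = \<one>" for x
  proof
    have xG: "x \<in> carrier G" using x C_carrier by blast
    have "(h \<otimes> x) \<otimes> (h \<otimes> x) = \<one>"
      using reversing_square[OF A reversing_mult_C[OF A h x(1)]] .
    then have "h \<otimes> x = inv (h \<otimes> x)" using G xG by (metis inv_equality m_closed)
    also have "\<dots> = x \<otimes> h"
      using G xG x(3) reversing_square[OF A h] by (simp add: inv_mult_group inv_equality)
    finally show "x \<in> N (axis h)" using commuting_in_N h1 xG by simp
    show "x \<notin> C (axis h)"
      using x xG h h1 C_iff[OF A, of x] C_iff[OF B, of x] C_iff[OF A, of h] by auto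
  qed
  have st: "s \<otimes> t \<noteq> \<one>" using \<open>s \<noteq> t\<close> G t(3) by (metis r_cancel)
  have "s \<otimes> t \<in> C (axis h)" using reversing_mult[OF B rev[OF s] rev[OF t]] .
  moreover have "s \<otimes> t \<in> C A"
    using s t subgroup_C[OF axes_subset[OF A]] subgroup.m_closed by metis
  ultimately have "axis h = A"
    using st G C_iff[OF A, of "s \<otimes> t"] C_iff[OF B, of "s \<otimes> t"] by auto
  then show False using h h1 C_iff[OF A, of h] by auto
qed

lemma cyclic_C:
  assumes fin: "finite (carrier G)" and A: "A \<in> axes"
    and c: "Factorial_Ring.prime (card (C A)) \<or> card (C A) = 4 \<and> card (N A) = 2 * card (C A)"
  shows "cyclic_group (G\<lparr>carrier := C A\<rparr>)"
proof -
  have sub: "subgroup (C A) G" using subgroup_C[OF axes_subset[OF A]] .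
  have finC: "finite (C A)" using fin C_carrier by (meson finite_subset subsetI)
  have one: "\<one> \<in> C A" using sub by (rule subgroup.one_closed)
  have dvd: "ord x dvd card (C A)" if "x \<in> C A" for x
    using that pow_eq_id C_carrier pow_card_subgroup[OF sub that] by blast
  have "\<exists>x\<in>C A. ord x = card (C A)"
  proof (cases "Factorial_Ring.prime (card (C A))")
    case True
    then have "1 < card (C A)" by (rule prime_gt_1_nat)
    then have "C A \<noteq> {\<one>}" by auto
    with one obtain x where x: "x \<in> C A" "x \<noteq> \<one>" by blast
    then have "ord x \<noteq> 1" using ord_eq_1 C_carrier by blast
    with dvd[OF x(1)] True x show ?thesis by (auto simp: prime_nat_iff)
  next
    case False
    with c have 4: "card (C A) = 4" "card (N A) = 8" by auto
    then have "C A \<noteq> N A" by auto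
    then obtain h where h: "h \<in> N A - C A" using C_subset_N by blast
    show ?thesis
    proof (rule ccontr)
      assume no: "\<not> (\<exists>x\<in>C A. ord x = card (C A))"
      have sq: "x \<otimes> x = \<one>" if x: "x \<in> C A" for x
      proof -
        have xG: "x \<in> carrier G" using x C_carrier by blast
        have "ord x dvd 2 ^ 2" "ord x \<noteq> 4" using dvd[OF x] no x 4 by auto
        moreover from this obtain i where "i \<le> 2" "ord x = 2 ^ i"
          using divides_primepow_nat two_is_prime_nat by blast
        moreover from this have "i = 0 \<or> i = 1 \<or> i = 2" by linarith
        ultimately have "ord x dvd 2" by auto
        then have "x [^] (2::nat) = \<one>" using xG pow_eq_id by blast
        then show ?thesis using xG by (simp add: numeral_2_eq_2)
      qed
      have "C A \<subseteq> {\<one>, s}" if s: "s \<in> C A" "s \<noteq> \<one>" for s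
        using involution_unique_in_C[OF A h] s sq by blast
      then obtain s where "C A \<subseteq> {\<one>, s}" by blast
      then have "card (C A) \<le> card {\<one>, s}" by (intro card_mono) auto
      also have "\<dots> \<le> 2" by (simp add: card_insert_if)
      finally show False using 4 by simp
    qed
  qed
  then show ?thesis using cyclic_subgroup_if_ord[OF sub finC] by blast
qed

section \<open>Orbits of axes\<close>

abbreviation axes_action where "axes_action \<equiv> (\<lambda>g. restrict (\<lambda>A. \<phi> g ` A) axes)"

interpretation ax: group_action G axes axes_action
  using image_axes image_one image_mult axes_subset by (intro group_action_restrictI) auto

abbreviation axis_orbits where "axis_orbits \<equiv> orbits G axes axes_action"

lemma axis_orbits_nonempty: "O1 \<in> axis_orbits \<Longrightarrow> \<exists>A. A \<in> O1"
  by (auto simp: orbits_def orbit_def)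

lemma axis_orbits_axes: "O1 \<in> axis_orbits \<Longrightarrow> A \<in> O1 \<Longrightarrow> A \<in> axes"
  using ax.orbits_coverture by blast

lemma axis_orbits_cover: "A \<in> axes \<Longrightarrow> \<exists>O1\<in>axis_orbits. A \<in> O1"
  using ax.orbits_coverture by blast

lemma axis_orbits_unique: "O1 \<in> axis_orbits \<Longrightarrow> O2 \<in> axis_orbits \<Longrightarrow> A \<in> O1 \<Longrightarrow> A \<in> O2 \<Longrightarrow> O1 = O2"
  using ax.disjoint_union by blast

lemma axis_orbits_eq_image:
  assumes "O1 \<in> axis_orbits" "A \<in> O1"
  shows "O1 = (\<lambda>g. \<phi> g ` A) ` carrier G"
proof -
  have A: "A \<in> axes" using assms axis_orbits_axes by blast
  have "A \<in> orbit G axes_action A" using ax.orbit_refl A by blast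
  then have "O1 = orbit G axes_action A"
    using axis_orbits_unique[OF assms(1) _ assms(2)] A by (auto simp: orbits_def)
  then show ?thesis using A by (auto simp: orbit_def)
qed

lemma axis_orbits_image: "O1 \<in> axis_orbits \<Longrightarrow> A \<in> O1 \<Longrightarrow> g \<in> carrier G \<Longrightarrow> \<phi> g ` A \<in> O1"
  using axis_orbits_eq_image by blast

lemma card_orbit_mult_N:
  assumes "O1 \<in> axis_orbits" "A \<in> O1"
  shows "card O1 * card (N A) = order G"
proof -
  have A: "A \<in> axes" using assms axis_orbits_axes by blast
  have "orbit G axes_action A = O1"
    using axis_orbits_eq_image[OF assms] A by (auto simp: orbit_def)
  moreover have "stabilizer G axes_action A = N A"
    using A by (auto simp: stabilizer_def setwise_stabilizer_def)
  ultimately show ?thesis using ax.orbit_stabilizer_theorem[OF A] by simp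
qed

lemma conj_image_C:
  assumes "h \<in> carrier G" "A \<subseteq> carrier V"
  shows "C (\<phi> h ` A) = (\<lambda>x. h \<otimes> x \<otimes> inv h) ` C A"
proof -
  have sub: "k \<otimes> x \<otimes> inv k \<in> C (\<phi> k ` B)" if "k \<in> carrier G" "B \<subseteq> carrier V" "x \<in> C B" for k B x
    using that C_carrier[OF that(3)]
    by (auto simp: pointwise_stabilizer_def subset_iff act_closed m_assoc simp flip: act_mult)
      (auto simp: act_mult act_closed)
  have "y \<in> (\<lambda>x. h \<otimes> x \<otimes> inv h) ` C A" if y: "y \<in> C (\<phi> h ` A)" for y
  proof -
    have yG: "y \<in> carrier G" using y C_carrier by blast
    have "inv h \<otimes> y \<otimes> inv (inv h) \<in> C (\<phi> (inv h) ` \<phi> h ` A)"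
      using sub[OF _ image_subset[OF assms] y] assms by blast
    then have "inv h \<otimes> y \<otimes> h \<in> C A"
      using assms by (simp add: image_one flip: image_mult)
    moreover have "y = h \<otimes> (inv h \<otimes> y \<otimes> h) \<otimes> inv h"
      using assms yG conjugation_is_surj by simp
    ultimately show ?thesis by blast
  qed
  with sub[OF assms] show ?thesis by blast
qed

lemma conj_image_N:
  assumes "h \<in> carrier G" "A \<subseteq> carrier V"
  shows "N (\<phi> h ` A) = (\<lambda>x. h \<otimes> x \<otimes> inv h) ` N A"
proof -
  have sub: "k \<otimes> x \<otimes> inv k \<in> N (\<phi> k ` B)" if "k \<in> carrier G" "B \<subseteq> carrier V" "x \<in> N B" for k B x
  proof -
    have x: "x \<in> carrier G" "\<phi> x ` B = B" using that(3) by (auto simp: setwise_stabilizer_def)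
    have "\<phi> (k \<otimes> x \<otimes> inv k) ` \<phi> k ` B = \<phi> (k \<otimes> x) ` B"
      using that x by (simp add: m_assoc flip: image_mult)
    also have "\<dots> = \<phi> k ` B" using that x by (simp add: image_mult)
    finally show ?thesis using that x by (simp add: setwise_stabilizer_def)
  qed
  have "y \<in> (\<lambda>x. h \<otimes> x \<otimes> inv h) ` N A" if y: "y \<in> N (\<phi> h ` A)" for y
  proof -
    have yG: "y \<in> carrier G" using y N_carrier by blast
    have "inv h \<otimes> y \<otimes> inv (inv h) \<in> N (\<phi> (inv h) ` \<phi> h ` A)"
      using sub[OF _ image_subset[OF assms] y] assms by blast
    then have "inv h \<otimes> y \<otimes> h \<in> N A"
      using assms by (simp add: image_one flip: image_mult)
    moreover have "y = h \<otimes> (inv h \<otimes> y \<otimes> h) \<otimes> inv h"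
      using assms yG conjugation_is_surj by simp
    ultimately show ?thesis by blast
  qed
  with sub[OF assms] show ?thesis by blast
qed

lemma card_conj:
  assumes "h \<in> carrier G" "S \<subseteq> carrier G"
  shows "card ((\<lambda>x. h \<otimes> x \<otimes> inv h) ` S) = card S"
  using assms conjugation_is_inj by (intro card_image inj_onI) blast

text \<open>The letters \<open>c\<close> and \<open>e\<close> are those of the class equation.\<close>
definition orbit_type where
  "orbit_type O1 c e \<longleftrightarrow> O1 \<in> axis_orbits \<and> (\<forall>A\<in>O1. card (C A) = c \<and> card (N A) = e * c)"

lemma orbit_typeI:
  assumes "O1 \<in> axis_orbits" "A \<in> O1" "card (C A) = c" "card (N A) = e * c"
  shows "orbit_type O1 c e"
proof -
  have A: "A \<subseteq> carrier V" using assms axis_orbits_axes axes_subset by blast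
  have "card (C B) = c \<and> card (N B) = e * c" if B: "B \<in> O1" for B
  proof -
    obtain h where h: "h \<in> carrier G" "B = \<phi> h ` A"
      using axis_orbits_eq_image[OF assms(1,2)] B by blast
    have "C A \<subseteq> carrier G" "N A \<subseteq> carrier G" using C_carrier N_carrier by blast+
    then show ?thesis
      using h assms card_conj[OF h(1)] conj_image_C[OF h(1) A] conj_image_N[OF h(1) A] by simp
  qed
  with assms(1) show ?thesis by (simp add: orbit_type_def)
qed

lemma orbit_type_order:
  assumes "orbit_type O1 c e"
  shows "card O1 * e * c = order G"
proof -
  obtain A where A: "A \<in> O1" using assms axis_orbits_nonempty by (auto simp: orbit_type_def)
  then show ?thesis using card_orbit_mult_N[OF _ A] assms by (simp add: orbit_type_def)
qed

section \<open>The class equation\<close>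

text \<open>For a single axis \<open>A\<close>, this is \<open>C(A) - {1}\<close>.\<close>
definition support where "support S = {h \<in> carrier G - {\<one>}. axis h \<in> S}"

lemma card_support:
  assumes fin: "finite (carrier G)" and S: "S \<subseteq> axes"
  shows "card (support S) = (\<Sum>A\<in>S. card (C A) - 1)"
proof -
  have "finite axes" using fin by (simp add: axes_def)
  then have finS: "finite S" using S finite_subset by blast
  have finC: "finite (C A)" for A using fin C_carrier by (meson finite_subset subsetI)
  have fib: "C A - {\<one>} = {h \<in> carrier G - {\<one>}. axis h = A}" if "A \<in> S" for A
    using that S C_iff C_carrier by blast
  then have disj: "(C A - {\<one>}) \<inter> (C B - {\<one>}) = {}" if "A \<in> S" "B \<in> S" "A \<noteq> B" for A B
    using that by auto
  from fib have "support S = (\<Union>A\<in>S. C A - {\<one>})" by (auto simp: support_def)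
  also have "card \<dots> = (\<Sum>A\<in>S. card (C A - {\<one>}))"
    using disj by (intro card_UN_disjoint) (simp_all add: finS finC)
  also have "\<dots> = (\<Sum>A\<in>S. card (C A) - 1)"
    using S C_iff finC by (intro sum.cong refl card_Diff_singleton) auto
  finally show ?thesis .
qed

lemma card_support_orbit:
  assumes "finite (carrier G)" "orbit_type O1 c e"
  shows "card (support O1) = card O1 * (c - 1)"
  using assms card_support[of O1] axis_orbits_axes by (auto simp: orbit_type_def)

lemma card_C_ge_2:
  assumes fin: "finite (carrier G)" and A: "A \<in> axes"
  shows "card (C A) \<ge> 2"
proof -
  obtain g where g: "g \<in> carrier G - {\<one>}" "A = axis g" using A by (auto simp: axes_def)
  then have "{\<one>, g} \<subseteq> C A" using C_iff[OF A] by auto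
  then have "card {\<one>, g} \<le> card (C A)"
    using fin C_carrier by (intro card_mono) (meson finite_subset subsetI)+
  with g show ?thesis by auto
qed

lemma orbit_type_exists:
  assumes fin: "finite (carrier G)" and "O1 \<in> axis_orbits"
  shows "\<exists>c e. orbit_type O1 c e \<and> c \<ge> 2 \<and> e \<in> {1, 2}"
proof -
  obtain A where A: "A \<in> O1" using assms axis_orbits_nonempty by blast
  have "card (N A) = 1 * card (C A) \<or> card (N A) = 2 * card (C A)"
    using card_N[OF fin] A assms axis_orbits_axes by auto
  then show ?thesis
    using orbit_typeI[OF assms(2) A refl] card_C_ge_2[OF fin] A assms axis_orbits_axes by blast
qed

lemma nonaxial_card_orbit_ge_2:
  assumes fin: "finite (carrier G)" and na: "\<not> axial G \<phi> axis" and O: "O1 \<in> axis_orbits"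
  shows "card O1 \<ge> 2"
proof -
  obtain A where A: "A \<in> O1" using O axis_orbits_nonempty by blast
  then obtain g where g: "g \<in> carrier G - {\<one>}" "A = axis g"
    using axis_orbits_axes[OF O] by (auto simp: axes_def)
  then obtain h where h: "h \<in> carrier G" "\<phi> h ` A \<noteq> A"
    using na unfolding axial_def by blast
  have "finite O1" using axis_orbits_eq_image[OF O A] fin by simp
  moreover have "{A, \<phi> h ` A} \<subseteq> O1" using A O axis_orbits_image h by blast
  ultimately have "card {A, \<phi> h ` A} \<le> card O1" by (intro card_mono)
  with h(2) show ?thesis by auto
qed

lemma nonaxial_orbit_types:
  assumes fin: "finite (carrier G)" and nt: "carrier G \<noteq> {\<one>}" and na: "\<not> axial G \<phi> axis"
  obtains (two) O1 O2 where "axis_orbits = {O1, O2}" "O1 \<noteq> O2" "orbit_type O1 3 1" "orbit_type O2 2 2"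
      "order G = 12"
    | (three) O1 O2 O3 c where "axis_orbits = {O1, O2, O3}" "O1 \<noteq> O2" "O2 \<noteq> O3" "O1 \<noteq> O3"
      "orbit_type O1 2 2" "orbit_type O2 3 2" "orbit_type O3 c 2"
      "c = 3 \<and> order G = 12 \<or> c = 4 \<and> order G = 24 \<or> c = 5 \<and> order G = 60"
proof -
  obtain c e where ce: "\<And>x. x \<in> axis_orbits \<Longrightarrow> orbit_type x (c x) (e x) \<and> c x \<ge> 2 \<and> e x \<in> {1, 2}"
    using orbit_type_exists[OF fin] by metis
  have finax: "finite axes" using fin by (simp add: axes_def)
  then have finO: "finite axis_orbits" by (simp add: orbits_def)
  have "(\<Sum>x\<in>axis_orbits. card x * (c x - 1)) = (\<Sum>x\<in>axis_orbits. \<Sum>A\<in>x. card (C A) - 1)"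
    using ce by (intro sum.cong) (auto simp: orbit_type_def)
  also have "\<dots> = (\<Sum>A\<in>axes. card (C A) - 1)" by (rule ax.disjoint_sum[OF finax])
  also have "\<dots> = card (support axes)" using card_support[OF fin, of axes] by simp
  also have "support axes = carrier G - {\<one>}" by (auto simp: support_def axes_def)
  also have "card \<dots> + 1 = order G"
    using fin order_gt_0_iff_finite by (simp add: order_def card_Diff_singleton)
  finally have eq: "(\<Sum>x\<in>axis_orbits. card x * (c x - 1)) + 1 = order G" .
  have "order G > 1"
  proof -
    obtain g where "g \<in> carrier G - {\<one>}" using nt one_closed by blast
    then have "card {\<one>, g} \<le> order G" "card {\<one>, g} = 2"
      unfolding order_def using fin by (auto intro!: card_mono)
    then show ?thesis by simp
  qed
  from class_equation_solutions[of axis_orbits c e card "order G", OF finO _ _ nonaxial_card_orbit_ge_2[OF fin na] _ eq this]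
  have "(\<exists>x y. axis_orbits = {x, y} \<and> x \<noteq> y \<and> c x = 3 \<and> e x = 1 \<and> c y = 2 \<and> e y = 2 \<and> order G = 12) \<or>
    (\<exists>x y z. axis_orbits = {x, y, z} \<and> x \<noteq> y \<and> y \<noteq> z \<and> x \<noteq> z \<and> e x = 2 \<and> e y = 2 \<and> e z = 2 \<and>
      c x = 2 \<and> c y = 3 \<and>
      (c z = 3 \<and> order G = 12 \<or> c z = 4 \<and> order G = 24 \<or> c z = 5 \<and> order G = 60))"
    using ce orbit_type_order by blast
  then show thesis
  proof
    assume "\<exists>x y. axis_orbits = {x, y} \<and> x \<noteq> y \<and> c x = 3 \<and> e x = 1 \<and> c y = 2 \<and> e y = 2 \<and> order G = 12"
    then obtain x y where *: "axis_orbits = {x, y}" "x \<noteq> y" "c x = 3" "e x = 1" "c y = 2" "e y = 2" "order G = 12" by blast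
    then have "x \<in> axis_orbits" "y \<in> axis_orbits" by blast+
    then have "orbit_type x (c x) (e x)" "orbit_type y (c y) (e y)" using ce by blast+
    with * show thesis by (intro two[of x y]) (simp_all del: One_nat_def)
  next
    assume "\<exists>x y z. axis_orbits = {x, y, z} \<and> x \<noteq> y \<and> y \<noteq> z \<and> x \<noteq> z \<and> e x = 2 \<and> e y = 2 \<and> e z = 2 \<and>
      c x = 2 \<and> c y = 3 \<and>
      (c z = 3 \<and> order G = 12 \<or> c z = 4 \<and> order G = 24 \<or> c z = 5 \<and> order G = 60)"
    then obtain x y z where *: "axis_orbits = {x, y, z}" "x \<noteq> y" "y \<noteq> z" "x \<noteq> z" "e x = 2" "e y = 2" "e z = 2"
      "c x = 2" "c y = 3" and cz: "c z = 3 \<and> order G = 12 \<or> c z = 4 \<and> order G = 24 \<or> c z = 5 \<and> order G = 60" by blast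
    from *(1) have "x \<in> axis_orbits" "y \<in> axis_orbits" "z \<in> axis_orbits" by blast+
    then have "orbit_type x (c x) (e x)" "orbit_type y (c y) (e y)" "orbit_type z (c z) (e z)"
      using ce by blast+
    with * have "orbit_type x 2 2" "orbit_type y 3 2" "orbit_type z (c z) 2" by simp_all
    from three[OF *(1-4) this cz] show thesis .
  qed
qed

section \<open>Faithful action on an orbit of axes\<close>

text \<open>
  A nontrivial \<open>g\<close> that fixes all axes of the orbit reverses each of them: it could fix only its own
  axis pointwise, and then it would be an involution (it reverses some other axis) in a group
  of odd order. A conjugate \<open>k\<close> of \<open>g\<close> has the same property, so \<open>g k\<close> fixes two axes pointwise and
  is trivial; as \<open>g\<close> is an involution, \<open>k = g\<close>. Thus \<open>g\<close> is central and its axis is invariant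
  under \<open>G\<close>, which contradicts nonaxiality.
\<close>
lemma axes_action_faithful:
  assumes fin: "finite (carrier G)" and na: "\<not> axial G \<phi> axis"
    and O: "orbit_type O1 c e" and odd: "odd c"
    and g: "g \<in> carrier G" and fix_all: "\<And>A. A \<in> O1 \<Longrightarrow> \<phi> g ` A = A"
  shows "g = \<one>"
proof (rule ccontr)
  assume g1: "g \<noteq> \<one>"
  have OO: "O1 \<in> axis_orbits" and c: "\<And>A. A \<in> O1 \<Longrightarrow> card (C A) = c" using O by (auto simp: orbit_type_def)
  have "card O1 \<ge> 2" using nonaxial_card_orbit_ge_2[OF fin na OO] .
  then have "\<not> O1 \<subseteq> {A}" for A using card_mono[of "{A}" O1] by auto
  then have other: "\<exists>B\<in>O1. B \<noteq> A" for A by blast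
  have ax: "A \<in> axes" if "A \<in> O1" for A using that OO axis_orbits_axes by blast
  have rev: "k \<in> N A - C A"
    if k: "k \<in> carrier G" "k \<noteq> \<one>" "\<And>A. A \<in> O1 \<Longrightarrow> \<phi> k ` A = A" and A: "A \<in> O1" for k A
  proof (rule ccontr)
    have kN: "k \<in> N B" if "B \<in> O1" for B using k that by (simp add: setwise_stabilizer_def)
    assume "k \<notin> N A - C A"
    then have kC: "k \<in> C A" using kN A by blast
    then have "axis k = A" using C_iff[OF ax[OF A] k(1)] k by simp
    obtain B where B: "B \<in> O1" "B \<noteq> A" using other by blast
    then have "k \<notin> C B" using C_iff[OF ax[OF B(1)] k(1)] k \<open>axis k = A\<close> by simp
    then have "k \<otimes> k = \<one>" using reversing_square[OF ax[OF B(1)], of k] kN[OF B(1)] by blast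
    then show False
      using odd_subgroup_no_involution[OF subgroup_C[OF axes_subset[OF ax[OF A]]] _ kC] c[OF A] odd k
      by simp
  qed
  have "axis (h \<otimes> g \<otimes> inv h) = axis g" if h: "h \<in> carrier G" for h
  proof -
    let ?k = "h \<otimes> g \<otimes> inv h"
    have k: "?k \<in> carrier G" "?k \<noteq> \<one>" using h g g1 conj_eq_one_iff by auto
    have kfix: "\<phi> ?k ` A = A" if A: "A \<in> O1" for A
    proof -
      have AV: "A \<subseteq> carrier V" using ax[OF A] axes_subset by blast
      have "\<phi> g ` \<phi> (inv h) ` A = \<phi> (inv h) ` A" using fix_all axis_orbits_image[OF OO A] h by simp
      then have "\<phi> ?k ` A = \<phi> h ` \<phi> (inv h) ` A"
        using h g AV image_subset by (simp add: image_mult)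
      also have "\<dots> = A" using h AV by (simp add: image_one flip: image_mult)
      finally show ?thesis .
    qed
    obtain A where A: "A \<in> O1" using OO axis_orbits_nonempty by blast
    \<comment> \<open>Both \<open>g\<close> and \<open>?k\<close> reverse every axis of the orbit, in particular two different ones.\<close>
    obtain B where B: "B \<in> O1" "B \<noteq> A" using other by blast
    have gk: "g \<otimes> ?k \<in> C D" if "D \<in> O1" for D
      using reversing_mult[OF ax[OF that] rev[OF g g1 fix_all that] rev[OF k kfix that]] .
    have "g \<otimes> ?k = \<one>"
      using gk[OF A] gk[OF B(1)] B(2) C_iff[OF ax[OF A], of "g \<otimes> ?k"] C_iff[OF ax[OF B(1)], of "g \<otimes> ?k"] g k
      by auto
    moreover have "g \<otimes> g = \<one>" using reversing_square[OF ax[OF A] rev[OF g g1 fix_all A]] .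
    ultimately have "?k = g" using g k by (metis l_cancel)
    then show ?thesis by simp
  qed
  then have "\<phi> h ` axis g = axis g" if "h \<in> carrier G" for h using image_axis g g1 that by simp
  then show False using na g g1 unfolding axial_def by blast
qed

lemma embedding_by_axes:
  assumes fin: "finite (carrier G)" and na: "\<not> axial G \<phi> axis"
    and O: "orbit_type O1 c e" and odd: "odd c"
  shows "\<exists>\<rho>\<in>hom G (sym_group (card O1)). inj_on \<rho> (carrier G)"
proof -
  have OO: "O1 \<in> axis_orbits" using O by (auto simp: orbit_type_def)
  have sub: "A \<subseteq> carrier V" if "A \<in> O1" for A using OO that axis_orbits_axes axes_subset by blast
  have act: "group_action G O1 (\<lambda>g. restrict (\<lambda>A. \<phi> g ` A) O1)"
    using axis_orbits_image[OF OO] image_one image_mult sub by (intro group_action_restrictI) auto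
  then interpret F: faithful_action G O1 "\<lambda>g. restrict (\<lambda>A. \<phi> g ` A) O1"
    using axes_action_faithful[OF fin na O odd] by (intro faithful_actionI) auto
  have "finite O1" using nonaxial_card_orbit_ge_2[OF fin na OO] by (metis card.infinite not_numeral_le_zero)
  then show ?thesis using F.embedding_into_sym_group by blast
qed

text \<open>
  Outside the support of the orbit \<open>O1\<close>, all elements have odd order. That support has one element
  for each axis of \<open>O1\<close>, which makes a quarter of the elements of \<open>G\<close>.
\<close>
lemma iso_alt_group_if_few_involutions:
  assumes fin: "finite (carrier G)" and O: "orbit_type O1 2 2"
    and odd: "\<forall>Q\<in>axis_orbits - {O1}. \<exists>c e. orbit_type Q c e \<and> odd c"
    and \<rho>: "\<rho> \<in> hom G (sym_group n)" "inj_on \<rho> (carrier G)"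
    and n: "2 * order G = fact n" "n \<ge> 2"
  shows "G \<cong> alt_group n"
proof (rule iso_alt_group[OF \<rho> n])
  let ?S = "carrier G - support O1"
  show "?S \<subseteq> carrier G" by blast
  have m: "card (support O1) = card O1" "card O1 * 2 * 2 = order G"
    using card_support_orbit[OF fin O] orbit_type_order[OF O] by simp_all
  have "card ?S = order G - card O1"
    using m fin by (subst card_Diff_subset) (auto simp: support_def order_def)
  moreover have "order G > 0" using fin by (simp add: order_gt_0_iff_finite)
  ultimately show "2 * card ?S > order G" using m(2) by linarith
  fix h assume h: "h \<in> ?S"
  show "\<exists>k. odd k \<and> h [^] (k::nat) = \<one>"
  proof (cases "h = \<one>")
    case True
    then show ?thesis by (intro exI[of _ 1]) simp
  next
    case False
    with h have ah: "axis h \<in> axes" "axis h \<notin> O1" by (auto simp: axes_def support_def)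
    then obtain O2 where O2: "O2 \<in> axis_orbits" "axis h \<in> O2" using axis_orbits_cover by blast
    with ah obtain c e where ce: "orbit_type O2 c e" "odd c" using odd by blast
    then have "odd (card (C (axis h)))" using O2 by (simp add: orbit_type_def)
    moreover have "h \<in> C (axis h)" using C_iff[OF ah(1), of h] h by simp
    ultimately show ?thesis
      using pow_card_subgroup[OF subgroup_C[OF axes_subset[OF ah(1)]]] by blast
  qed
qed

section \<open>Normalizers that are Klein four-groups\<close>

text \<open>
  \<open>N(A)\<close> has order 4, and all of its elements are involutions or trivial, so it is a Klein
  four-group. The third claim makes these subgroups classes of commuting involutions: for any
  nontrivial \<open>x\<close> in \<open>N(A)\<close>, the group \<open>N(A)\<close> commutes with \<open>x\<close>, so it lies in \<open>N(axis x)\<close>, and both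
  have order 4.
\<close>
lemma klein_normalizers:
  assumes fin: "finite (carrier G)" and O: "orbit_type O1 2 2"
    and odd: "\<forall>Q\<in>axis_orbits - {O1}. \<exists>c e. orbit_type Q c e \<and> odd c"
    and A: "A \<in> O1"
  shows "x \<in> N A \<Longrightarrow> x \<otimes> x = \<one>"
    and "x \<in> N A \<Longrightarrow> y \<in> N A \<Longrightarrow> x \<otimes> y = y \<otimes> x"
    and "x \<in> N A \<Longrightarrow> x \<noteq> \<one> \<Longrightarrow> axis x \<in> O1 \<and> N (axis x) = N A"
proof -
  have OO: "O1 \<in> axis_orbits" using O by (simp add: orbit_type_def)
  have Aax: "A \<in> axes" using A OO axis_orbits_axes by blast
  interpret N: subgroup "N A" G by (rule subgroup_N[OF axes_subset[OF Aax]])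
  show sq: "x \<otimes> x = \<one>" if x: "x \<in> N A" for x
  proof (cases "x \<in> C A")
    case True
    have "x [^] (2::nat) = \<one>"
      using pow_card_subgroup[OF subgroup_C[OF axes_subset[OF Aax]] True] O A
      by (simp add: orbit_type_def)
    then show ?thesis using x by (simp add: numeral_2_eq_2)
  next
    case False
    with x show ?thesis using reversing_square[OF Aax] by blast
  qed
  show comm: "x \<otimes> y = y \<otimes> x" if x: "x \<in> N A" and y: "y \<in> N A" for x y
  proof -
    have "inv (x \<otimes> y) = x \<otimes> y" "inv x = x" "inv y = y"
      using sq[of x] sq[of y] sq[of "x \<otimes> y"] x y by (auto intro: inv_equality)
    then show ?thesis using x y by (metis N.mem_carrier inv_mult_group)
  qed
  assume x: "x \<in> N A" "x \<noteq> \<one>"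
  then have xG: "x \<in> carrier G - {\<one>}" by simp
  then have xax: "axis x \<in> axes" by (simp add: axes_def)
  have xO: "axis x \<in> O1"
  proof (rule ccontr)
    assume "axis x \<notin> O1"
    moreover obtain O2 where O2: "O2 \<in> axis_orbits" "axis x \<in> O2" using axis_orbits_cover[OF xax] by blast
    ultimately obtain c e where "orbit_type O2 c e" "odd c" using odd by blast
    then have "odd (card (C (axis x)))" using O2 by (simp add: orbit_type_def)
    moreover have "x \<in> C (axis x)" using C_iff[OF xax, of x] xG by simp
    ultimately show False
      using odd_subgroup_no_involution[OF subgroup_C[OF axes_subset[OF xax]] _ _ sq[OF x(1)]] x by blast
  qed
  moreover have "N A \<subseteq> N (axis x)"
  proof
    fix y assume y: "y \<in> N A"
    then show "y \<in> N (axis x)" using commuting_in_N[OF xG _ comm[OF y x(1)]] by simp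
  qed
  moreover have "card (N A) = card (N (axis x))" using O A xO by (simp add: orbit_type_def)
  moreover have "finite (N (axis x))" using fin N_carrier by (meson finite_subset subsetI)
  ultimately show "axis x \<in> O1 \<and> N (axis x) = N A" by (metis card_subset_eq)
qed

text \<open>
  The 15 elements in the support of \<open>O1\<close> fall into classes of size 3, so there are five Klein
  four-groups \<open>N(A)\<close>. Let \<open>K\<close> be the kernel of the conjugation action on them. If a nontrivial \<open>t\<close>
  lies in \<open>K\<close> and in one of them, then \<open>t\<close> normalizes another one, \<open>N(B)\<close>, and commutes with some
  nontrivial element \<open>d\<close> of it, so \<open>t\<close> lies in \<open>N(axis d) = N(B)\<close>, although distinct groups
  of this kind meet trivially. So \<open>K\<close> meets each \<open>N(A)\<close> trivially. As both subgroups
  normalize each other, they commute, and then \<open>K\<close> lies in \<open>N(A)\<close> too.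
\<close>
lemma embedding_by_klein_normalizers:
  assumes fin: "finite (carrier G)" and O: "orbit_type O1 2 2"
    and odd: "\<forall>Q\<in>axis_orbits - {O1}. \<exists>c e. orbit_type Q c e \<and> odd c"
    and ord: "order G = 60"
  shows "\<exists>\<rho>\<in>hom G (sym_group 5). inj_on \<rho> (carrier G)"
proof -
  note klein = klein_normalizers[OF fin O odd]
  have OO: "O1 \<in> axis_orbits" using O by (simp add: orbit_type_def)
  have Oax: "A \<in> axes" if "A \<in> O1" for A using that OO axis_orbits_axes by blast
  have Osub: "A \<subseteq> carrier V" if "A \<in> O1" for A using Oax[OF that] axes_subset by blast
  have finO: "finite O1" using axis_orbits_eq_image[OF OO] axis_orbits_nonempty[OF OO] fin by (metis finite_imageI)
  have finN: "finite (N A)" for A using fin N_carrier by (meson finite_subset subsetI)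
  have subN: "subgroup (N A) G" if "A \<in> O1" for A using subgroup_N[OF Osub[OF that]] .
  define P where "P = N ` O1"
  have meet: "N A = N B" if "A \<in> O1" "B \<in> O1" "x \<in> N A" "x \<in> N B" "x \<noteq> \<one>" for A B x
    using klein(3)[OF that(1) that(3) that(5)] klein(3)[OF that(2) that(4) that(5)] by simp
  have finP: "finite P" using finO by (simp add: P_def)
  have finQ: "finite Q" if "Q \<in> P" for Q using that finN by (auto simp: P_def)
  have disj: "(Q - {\<one>}) \<inter> (R - {\<one>}) = {}" if "Q \<in> P" "R \<in> P" "Q \<noteq> R" for Q R
    using that meet unfolding P_def by blast
  have card_P: "card P = 5"
  proof -
    have "support O1 = (\<Union>Q\<in>P. Q - {\<one>})"
    proof
      show "support O1 \<subseteq> (\<Union>Q\<in>P. Q - {\<one>})"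
      proof
        fix x assume x: "x \<in> support O1"
        then have xG: "x \<in> carrier G - {\<one>}" "axis x \<in> O1" by (auto simp: support_def)
        then have "x \<in> N (axis x)" using commuting_in_N by simp
        then show "x \<in> (\<Union>Q\<in>P. Q - {\<one>})" using xG by (auto simp: P_def)
      qed
      show "(\<Union>Q\<in>P. Q - {\<one>}) \<subseteq> support O1"
        using klein(3) N_carrier by (auto simp: P_def support_def)
    qed
    also have "card (\<Union>Q\<in>P. Q - {\<one>}) = (\<Sum>Q\<in>P. card (Q - {\<one>}))"
      using disj by (intro card_UN_disjoint) (simp_all add: finP finQ)
    also have "\<dots> = (\<Sum>Q\<in>P. 3)"
    proof (rule sum.cong[OF refl])
      fix Q assume "Q \<in> P"
      then obtain A where A: "A \<in> O1" "Q = N A" by (auto simp: P_def)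
      then have "card Q = 4" "\<one> \<in> Q"
        using O subgroup.one_closed[OF subN[OF A(1)]] by (auto simp: orbit_type_def)
      then show "card (Q - {\<one>}) = 3" by simp
    qed
    finally have "card (support O1) = 3 * card P" by simp
    moreover have "card (support O1) = 15"
      using card_support_orbit[OF fin O] orbit_type_order[OF O] ord by simp
    ultimately show ?thesis by simp
  qed
  let ?conj = "\<lambda>g Q. (\<lambda>x. g \<otimes> x \<otimes> inv g) ` Q"
  have P_carrier: "Q \<subseteq> carrier G" if "Q \<in> P" for Q using that N_carrier by (auto simp: P_def)
  define \<psi> where "\<psi> = (\<lambda>g. restrict (?conj g) P)"
  have act: "group_action G P \<psi>"
    unfolding \<psi>_def
  proof (rule group_action_restrictI)
    show "?conj g Q \<in> P" if g: "g \<in> carrier G" and Q: "Q \<in> P" for g Q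
    proof -
      obtain A where A: "A \<in> O1" "Q = N A" using Q by (auto simp: P_def)
      have "?conj g Q = N (\<phi> g ` A)" using conj_image_N[OF g Osub[OF A(1)]] A(2) by simp
      then show ?thesis using axis_orbits_image[OF OO A(1) g] by (simp add: P_def)
    qed
    show "?conj \<one> Q = Q" if Q: "Q \<in> P" for Q
    proof -
      have "?conj \<one> Q = (\<lambda>x. x) ` Q"
      proof (rule image_cong[OF refl])
        fix x assume "x \<in> Q"
        then have "x \<in> carrier G" using P_carrier[OF Q] by blast
        then show "\<one> \<otimes> x \<otimes> inv \<one> = x" by simp
      qed
      then show ?thesis by simp
    qed
    show "?conj (g \<otimes> h) Q = ?conj g (?conj h Q)"
      if g: "g \<in> carrier G" and h: "h \<in> carrier G" and Q: "Q \<in> P" for g h Q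
      unfolding image_image
    proof (rule image_cong[OF refl])
      fix x assume "x \<in> Q"
      then have "x \<in> carrier G" using P_carrier[OF Q] by blast
      then show "g \<otimes> h \<otimes> x \<otimes> inv (g \<otimes> h) = g \<otimes> (h \<otimes> x \<otimes> inv h) \<otimes> inv g"
        using g h by (simp add: inv_mult_group m_assoc)
    qed
  qed
  have one_Bij: "\<one>\<^bsub>BijGroup P\<^esub> = (\<lambda>Q\<in>P. Q)" by (simp add: BijGroup_def)
  have \<psi>_hom: "group_hom G (BijGroup P) \<psi>" using act by (rule group_action.group_hom)
  define K where "K = kernel G (BijGroup P) \<psi>"
  have K_normal: "normal K G" unfolding K_def using \<psi>_hom by (rule group_hom.normal_kernel)
  have K_carrier: "k \<in> carrier G" if "k \<in> K" for k using that unfolding K_def kernel_def by blast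
  have K_fix: "k \<otimes> x \<otimes> inv k \<in> N A" if k: "k \<in> K" and A: "A \<in> O1" and x: "x \<in> N A" for k A x
  proof -
    have id: "restrict (?conj k) P = (\<lambda>Q\<in>P. Q)"
      using k unfolding K_def kernel_def \<psi>_def one_Bij by blast
    have P: "N A \<in> P" using A by (simp add: P_def)
    then have "?conj k (N A) = restrict (?conj k) P (N A)" by simp
    also have "\<dots> = N A" unfolding id using P by simp
    finally have "?conj k (N A) = N A" .
    then show ?thesis using x by blast
  qed
  have meet_trivial: "t = \<one>" if tK: "t \<in> K" and A: "A \<in> O1" and tA: "t \<in> N A" for t A
  proof (rule ccontr)
    assume t1: "t \<noteq> \<one>"
    have t: "t \<in> carrier G" "t \<otimes> t = \<one>" using tA N_carrier klein(1)[OF A] by blast+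
    then have invt: "inv t = t" by (simp add: inv_equality)
    have "\<not> P \<subseteq> {N A}" using card_P card_mono[of "{N A}" P] by auto
    then obtain B where B: "B \<in> O1" "N B \<noteq> N A" by (auto simp: P_def)
    interpret NB: subgroup "N B" G by (rule subN[OF B(1)])
    have "card (N B) = 4" using O B by (simp add: orbit_type_def)
    then have "N B \<noteq> {\<one>}" by auto
    then obtain a where a: "a \<in> N B" "a \<noteq> \<one>" using NB.one_closed by blast
    \<comment> \<open>Conjugation by \<open>t\<close> swaps \<open>a\<close> and \<open>b\<close>, so it fixes \<open>a\<close> if they are equal, and \<open>a \<otimes> b\<close> otherwise.\<close>
    define b where "b = t \<otimes> a \<otimes> t"
    have b: "b \<in> N B" using K_fix[OF tK B(1) a(1)] invt by (simp add: b_def)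
    have G: "a \<in> carrier G" "b \<in> carrier G" using a b by simp_all
    have tt: "t \<otimes> (t \<otimes> x) = x" if "x \<in> carrier G" for x
      using that t by (simp flip: m_assoc)
    obtain d where d: "d \<in> N B" "d \<noteq> \<one>" "t \<otimes> d = d \<otimes> t"
    proof (cases "b = a")
      case True
      then have "t \<otimes> (t \<otimes> a \<otimes> t) = t \<otimes> a" by (simp add: b_def)
      then have "t \<otimes> a = a \<otimes> t" using G t by (simp add: m_assoc tt)
      with a that show ?thesis by blast
    next
      case False
      have ta: "t \<otimes> a = b \<otimes> t" using G t by (simp add: b_def m_assoc)
      have tb: "t \<otimes> b = a \<otimes> t" using G t by (simp add: b_def m_assoc tt)
      have "t \<otimes> (a \<otimes> b) = (t \<otimes> a) \<otimes> b" using G t by (simp add: m_assoc)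
      also have "\<dots> = b \<otimes> (t \<otimes> b)" using G t by (simp add: ta m_assoc)
      also have "\<dots> = (b \<otimes> a) \<otimes> t" using G t by (simp add: tb m_assoc)
      also have "b \<otimes> a = a \<otimes> b" using klein(2)[OF B(1) b a(1)] .
      finally have "t \<otimes> (a \<otimes> b) = (a \<otimes> b) \<otimes> t" .
      moreover have "a \<otimes> b \<noteq> \<one>"
        using False klein(1)[OF B(1) a(1)] G by (metis l_cancel)
      ultimately show ?thesis using that[of "a \<otimes> b"] a b by simp
    qed
    have "t \<in> N (axis d)" using commuting_in_N d t by simp
    then have "t \<in> N B" using klein(3)[OF B(1) d(1,2)] by simp
    then show False using meet[OF A B(1) tA] t1 B(2) by blast
  qed
  have K_trivial: "k = \<one>" if k: "k \<in> K" for k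
  proof -
    have kG: "k \<in> carrier G" using k by (rule K_carrier)
    obtain A where A: "A \<in> O1" using axis_orbits_nonempty[OF OO] by blast
    interpret NA: subgroup "N A" G by (rule subN[OF A])
    have "card (N A) = 4" using O A by (simp add: orbit_type_def)
    then have "N A \<noteq> {\<one>}" by auto
    then obtain p where p: "p \<in> N A" "p \<noteq> \<one>" using NA.one_closed by blast
    have pG: "p \<in> carrier G" using p by simp
    \<comment> \<open>The commutator of \<open>k\<close> and \<open>p\<close> lies in \<open>N A\<close> and in \<open>K\<close>.\<close>
    have "k \<otimes> p \<otimes> inv k \<otimes> inv p \<in> N A" using K_fix[OF k A p(1)] p by simp
    moreover have "k \<otimes> (p \<otimes> inv k \<otimes> inv p) \<in> K"
    proof -
      interpret K: normal K G by (rule K_normal)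
      show ?thesis using k pG K.inv_op_closed2 by simp
    qed
    ultimately have "k \<otimes> p \<otimes> inv k \<otimes> inv p = \<one>"
      using meet_trivial[OF _ A] kG pG by (simp add: m_assoc)
    then have "k \<otimes> p = p \<otimes> k"
      using kG pG by (metis inv_closed inv_equality inv_inv inv_solve_right m_closed)
    then have "k \<in> N (axis p)" using commuting_in_N p pG kG by simp
    then have "k \<in> N A" using klein(3)[OF A p] by simp
    then show ?thesis using meet_trivial[OF k A] by simp
  qed
  have "inj_on \<psi> (carrier G)"
    using K_trivial unfolding group_hom.inj_on_one_iff[OF \<psi>_hom] K_def kernel_def by blast
  then have "faithful_action G P \<psi>"
    using act by (simp add: faithful_action_def faithful_action_axioms_def)
  from faithful_action.embedding_into_sym_group[OF this finP card_P] show ?thesis .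
qed

text \<open>
  Of the three-orbit cases, the one of order 12 does not occur: its second orbit would have two axes,
  and \<open>G\<close> would embed into the symmetric group on them.
\<close>
theorem classification:
  assumes fin: "finite (carrier G)" and nt: "carrier G \<noteq> {\<one>}" and na: "\<not> axial G \<phi> axis"
  shows "(G \<cong> alt_group 4 \<or> G \<cong> sym_group 4 \<or> G \<cong> alt_group 5) \<and>
    (\<forall>A\<in>axes. cyclic_group (G\<lparr>carrier := C A\<rparr>))"
  using assms
proof (cases rule: nonaxial_orbit_types)
  case (two O1 O2)
  have "card O1 * 1 * 3 = 12" using orbit_type_order[OF two(3)] two(5) by (simp del: One_nat_def)
  then have "card O1 = 4" by simp
  with embedding_by_axes[OF fin na two(3)] obtain \<rho>
    where \<rho>: "\<rho> \<in> hom G (sym_group 4)" "inj_on \<rho> (carrier G)" by auto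
  have "axis_orbits - {O2} = {O1}" using two(1,2) by blast
  then have "\<forall>Q\<in>axis_orbits - {O2}. \<exists>c e. orbit_type Q c e \<and> odd c"
    using two(3) odd_numeral by (metis singletonD)
  from iso_alt_group_if_few_involutions[OF fin two(4) this \<rho>] two(5) have "G \<cong> alt_group 4"
    by (simp add: fact_numeral)
  moreover have "cyclic_group (G\<lparr>carrier := C A\<rparr>)" if A: "A \<in> axes" for A
  proof -
    have "card (C A) = 2 \<or> card (C A) = 3"
      using axis_orbits_cover[OF A] two(1,3,4) by (auto simp: orbit_type_def)
    then show ?thesis using cyclic_C[OF fin A] by auto
  qed
  ultimately show ?thesis by blast
next
  case (three O1 O2 O3 c)
  have cyc: "cyclic_group (G\<lparr>carrier := C A\<rparr>)" if A: "A \<in> axes" for A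
  proof -
    have "card (C A) = 2 \<or> card (C A) = 3 \<or> card (C A) = c \<and> card (N A) = 2 * card (C A)"
      using axis_orbits_cover[OF A] three(1,5,6,7) by (auto simp: orbit_type_def)
    then show ?thesis using cyclic_C[OF fin A] three(8) by auto
  qed
  have m2: "card O2 * 2 * 3 = order G" using orbit_type_order[OF three(6)] .
  from embedding_by_axes[OF fin na three(6)] obtain \<rho>
    where \<rho>: "\<rho> \<in> hom G (sym_group (card O2))" "inj_on \<rho> (carrier G)" by auto
  from three(8) consider "order G = 12" | "order G = 24" | "c = 5" "order G = 60" by blast
  then have "G \<cong> sym_group 4 \<or> G \<cong> alt_group 5"
  proof cases
    case 1
    then have "card O2 = 2" using m2 by simp
    have "\<rho> ` carrier G \<subseteq> carrier (sym_group (card O2))" using \<rho>(1) by (rule hom_carrier)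
    then have "card (\<rho> ` carrier G) \<le> card (carrier (sym_group (card O2)))"
      by (intro card_mono) (simp_all add: sym_group_def finite_permutations)
    then have "card (\<rho> ` carrier G) \<le> fact 2"
      by (simp only: sym_group_card_carrier \<open>card O2 = 2\<close>)
    then have "order G \<le> fact 2" using card_image[OF \<rho>(2)] by (simp add: order_def)
    with 1 show ?thesis by simp
  next
    case 2
    then have "card O2 = 4" using m2 by simp
    then show ?thesis using iso_sym_group[OF \<rho>] 2 by (simp add: fact_numeral)
  next
    case 3
    have "axis_orbits - {O1} = {O2, O3}" using three(1-4) by blast
    moreover have "orbit_type O3 5 2" using three(7) 3 by simp
    ultimately have odd: "\<forall>Q\<in>axis_orbits - {O1}. \<exists>c e. orbit_type Q c e \<and> odd c"
      using three(6) odd_numeral by (metis insertE singletonD)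
    obtain \<sigma> where \<sigma>: "\<sigma> \<in> hom G (sym_group 5)" "inj_on \<sigma> (carrier G)"
      using embedding_by_klein_normalizers[OF fin three(5) odd 3(2)] by blast
    then show ?thesis
      using iso_alt_group_if_few_involutions[OF fin three(5) odd \<sigma>] 3(2) by (simp add: fact_numeral)
  qed
  with cyc show ?thesis by blast
qed

end

theorem theorem1:
  fixes G :: "('g, 'm) monoid_scheme"
    and V :: "('v, 'n) monoid_scheme"
    and \<phi> :: "'g \<Rightarrow> 'v \<Rightarrow> 'v"
    and axis :: "'g \<Rightarrow> 'v set"
  assumes "rotation_module_3D G V \<phi> axis"
    and "finite (carrier G)"
    and "carrier G \<noteq> {\<one>\<^bsub>G\<^esub>}"
    and "\<not> axial G \<phi> axis"
  shows "(G \<cong> alt_group 4 \<or> G \<cong> sym_group 4 \<or> G \<cong> alt_group 5) \<and>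
    (\<forall>g\<in>carrier G - {\<one>\<^bsub>G\<^esub>}.
      cyclic_group (G\<lparr>carrier := pointwise_stabilizer G \<phi> (axis g)\<rparr>))"
proof -
  interpret rotation_module_3D G V \<phi> axis by fact
  show ?thesis using classification[OF assms(2-4)] by (auto simp: axes_def)
qed

end
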